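(* Let $\Omega=\{z=(z_1,z_2,z_3)\in\mathbb{C}^3 \mid \operatorname{Re} z_3+|z_1^2-z_2^3|^2<0\}$. Let $0<t<1$, let $z_t=(0,0,-t)\in\Omega$, and let $X=(a,b,0)$ with $a,b\in\mathbb{C}$, $a\neq 0$ and $|a|^2+|b|^2=1$. Assume that $$\frac{|b|^3}{|a|^3}\le \frac{2}{\sqrt{t}}\min\left\{2\pi,\ \log\left(1+2t^{1/4}\right)\right\}.$$ Then $$K_\Omega(z_t,X)=|a|\,t^{-1/4}.$$
   Context: $\mathbb{D}=\{\zeta\in\mathbb{C} \mid |\zeta|<1\}$. For a domain $\Omega\subset\mathbb{C}^n$, $p\in\Omega$, $v\in\mathbb{C}^n$, the Kobayashi pseudometric is $$K_\Omega(p,v)=\inf\Big\{\tfrac1r>0 \ \Big|\ \exists f:\mathbb{D}\to\Omega \text{ holomorphic},\ f(0)=p,\ f'(0)=r\,v\Big\},$$ with $r>0$. *)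

theory Defs
  imports "HOL-Complex_Analysis.Complex_Analysis"
begin

text \<open>Functions of one complex variable with values in \<open>\<complex>\<^sup>n\<close> are treated componentwise, since
  \<^const>\<open>holomorphic_on\<close> and \<^const>\<open>deriv\<close> require values in the scalar field.\<close>

definition holomorphic_map_on :: "(complex \<Rightarrow> complex ^ 'n) \<Rightarrow> complex set \<Rightarrow> bool"
  where "holomorphic_map_on f S \<longleftrightarrow> (\<forall>i. (\<lambda>z. f z $ i) holomorphic_on S)"

definition deriv_map :: "(complex \<Rightarrow> complex ^ 'n) \<Rightarrow> complex \<Rightarrow> complex ^ 'n"
  where "deriv_map f z = (\<chi> i. deriv (\<lambda>w. f w $ i) z)"

text \<open>Meant for a domain \<open>\<Omega>\<close> and \<open>p \<in> \<Omega>\<close>: then the set below is nonempty (small affine discs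
  through \<open>p\<close> lie in \<open>\<Omega>\<close>) and bounded below by \<open>0\<close>, so the infimum of reals is the true one.\<close>

definition kobayashi :: "(complex ^ 'n) set \<Rightarrow> complex ^ 'n \<Rightarrow> complex ^ 'n \<Rightarrow> real"
  where "kobayashi \<Omega> p v =
    Inf {1 / r | r :: real. r > 0 \<and>
      (\<exists>f. holomorphic_map_on f (ball 0 1) \<and> f ` ball 0 1 \<subseteq> \<Omega> \<and>
           f 0 = p \<and> deriv_map f 0 = r *\<^sub>R v)}"

definition cusp_domain :: "(complex ^ 3) set"
  where "cusp_domain = {z. Re (z $ 3) + (cmod ((z $ 1)\<^sup>2 - (z $ 2) ^ 3))\<^sup>2 < 0}"

lemma open_cusp_domain: "open cusp_domain"
  unfolding cusp_domain_def by (intro open_Collect_less continuous_intros)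

lemma base_point_in_cusp_domain:
  fixes t :: real
  assumes "0 < t"
  shows "vector [0, 0, - of_real t] \<in> cusp_domain"
  using assms by (simp add: cusp_domain_def)

end

theory Submission
  imports Defs
begin

text \<open>Lower bound: for a competing disc \<open>f\<close> write \<open>f\<^sub>1\<^sup>2 - f\<^sub>2\<^sup>3 = z\<^sup>2 k\<close>. As
  \<open>2 Re (cnj (k 0) * k) - |k 0|\<^sup>2 \<le> |k|\<^sup>2\<close>, the maximum principle for
  \<open>f\<^sub>3 + s\<^sup>4 (2 cnj (k 0) k - |k 0|\<^sup>2)\<close> on \<open>|z| \<le> s\<close> gives \<open>s\<^sup>4 |k 0|\<^sup>2 \<le> t\<close>.

  Upper bound: equality forces \<open>f\<^sub>3 = -t\<close> and \<open>f\<^sub>1\<^sup>2 - f\<^sub>2\<^sup>3 = r\<^sup>2 a\<^sup>2 z\<^sup>2\<close>, so one needs a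
  function \<open>u\<close> with \<open>u 0 = 1\<close> and prescribed derivative at \<open>0\<close> that is a square while
  \<open>(u - 1) / z\<close> is a cube. The choice \<open>u = ((1 + k z) / (1 - k z))\<^sup>2\<close> has
  \<open>u - 1 = 4 k z / (1 - k z)\<^sup>2\<close>; it is defined on the unit disc as soon as \<open>|k| \<le> 1\<close>,
  and \<open>ln (1 + x) \<le> x\<close> shows that the hypothesis implies this.\<close>

lemma holomorphic_factor_zero_at_0:
  fixes f :: "complex \<Rightarrow> complex"
  assumes "f holomorphic_on S" "open S" "0 \<in> S" "f 0 = 0"
  obtains g where "g holomorphic_on S" "\<And>z. f z = z * g z" "g 0 = deriv f 0"
proof
  let ?g = "\<lambda>z. if z = 0 then deriv f 0 else f z / z"
  show "?g holomorphic_on S"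
    by (rule pole_theorem_open_0[OF assms(1,2), of 0]) (use assms(4) in auto)
qed (use assms(4) in auto)

text \<open>The modulus of \<open>exp (G z)\<close> is \<open>exp (Re (G z))\<close>, so the maximum
  modulus principle for \<open>exp (G z)\<close> on the disc of radius \<open>s\<close> carries the
  sign of \<open>Re G\<close> from the circle to the centre.\<close>

lemma Re_le_0_center:
  assumes G: "G holomorphic_on ball 0 1" and s: "0 < s" "s < 1"
    and le: "\<And>z. cmod z = s \<Longrightarrow> Re (G z) \<le> 0"
  shows "Re (G 0) \<le> 0"
proof -
  have sub: "cball 0 s \<subseteq> ball (0::complex) 1"
    using s by auto
  have hol: "(\<lambda>z. exp (G z)) holomorphic_on cball 0 s"
    by (intro holomorphic_intros holomorphic_on_subset[OF G sub])
  have "cmod (exp (G 0)) \<le> 1"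
  proof (rule maximum_modulus_frontier[of "\<lambda>z. exp (G z)" "cball 0 s"])
    show "(\<lambda>z. exp (G z)) holomorphic_on interior (cball 0 s)"
      using hol holomorphic_on_subset interior_subset by blast
    show "continuous_on (closure (cball 0 s)) (\<lambda>z. exp (G z))"
      using hol by (simp add: holomorphic_on_imp_continuous_on)
    show "cmod (exp (G z)) \<le> 1" if "z \<in> frontier (cball 0 s)" for z
      using that le s by (simp add: frontier_cball)
  qed (use s in auto)
  then show ?thesis by simp
qed

lemma cusp_disc_derivative_bound:
  fixes t r :: real and a b c :: complex
  assumes hol: "holomorphic_map_on f (ball 0 1)" and im: "f ` ball 0 1 \<subseteq> cusp_domain"
    and f0: "f 0 = vector [0, 0, - of_real t]"
    and df: "deriv_map f 0 = r *\<^sub>R vector [a, b, c]"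
  shows "(\<bar>r\<bar> * cmod a) ^ 4 \<le> t"
proof -
  have hol1: "(\<lambda>z. f z $ i) holomorphic_on ball 0 1" for i
    using hol by (auto simp: holomorphic_map_on_def)
  have f0s: "f 0 $ 1 = 0" "f 0 $ 2 = 0" "f 0 $ 3 = - of_real t"
    by (simp_all add: f0)
  have d1: "deriv (\<lambda>z. f z $ 1) 0 = of_real r * a"
    using arg_cong[OF df, of "\<lambda>v::complex^3. v $ 1"] by (simp add: deriv_map_def scaleR_conv_of_real[of r a])
  obtain g where g: "g holomorphic_on ball 0 1" "\<And>z. f z $ 1 = z * g z" "g 0 = of_real r * a"
    by (rule holomorphic_factor_zero_at_0[OF hol1[of 1]]) (use f0s d1 in auto)
  obtain h where h: "h holomorphic_on ball 0 1" "\<And>z. f z $ 2 = z * h z"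
    by (rule holomorphic_factor_zero_at_0[OF hol1[of 2]]) (use f0s in auto)
  \<comment> \<open>Both components vanish at 0, so the cube contributes order 3 and the square
    order 2. Dividing by \<open>z\<^sup>2\<close> leaves a factor \<open>z\<close> on the cube,
    whence \<open>k 0\<close> depends on \<open>r * a\<close> alone.\<close>
  define k where "k z = (g z)\<^sup>2 - z * h z ^ 3" for z
  have k0: "cmod (k 0) = (\<bar>r\<bar> * cmod a)\<^sup>2"
    by (simp add: k_def g(3) norm_mult norm_power)
  have bound: "s ^ 4 * (\<bar>r\<bar> * cmod a) ^ 4 \<le> t" if s: "0 < s" "s < 1" for s
  proof -
    \<comment> \<open>The squared modulus of \<open>k z\<close> is replaced by its tangent at
      \<open>k 0\<close>, the real part of a holomorphic function. Nothing is lost at the centre,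
      where the two agree. The weight \<open>s ^ 4\<close> is the squared modulus of
      \<open>z\<^sup>2\<close> on the circle.\<close>
    define G where "G z = f z $ 3 + of_real (s ^ 4) * (2 * cnj (k 0) * k z - of_real ((cmod (k 0))\<^sup>2))" for z
    have "Re (G 0) \<le> 0"
    proof (rule Re_le_0_center[OF _ s])
      show "G holomorphic_on ball 0 1"
        unfolding G_def k_def by (intro holomorphic_intros hol1 g(1) h(1))
      fix z assume z: "cmod z = s"
      then have "f z \<in> cusp_domain" using im s by auto
      moreover have "(f z $ 1)\<^sup>2 - f z $ 2 ^ 3 = z\<^sup>2 * k z"
        by (simp add: g(2) h(2) k_def algebra_simps power2_eq_square power3_eq_cube)
      ultimately have *: "Re (f z $ 3) + s ^ 4 * (cmod (k z))\<^sup>2 < 0"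
        using z by (simp add: cusp_domain_def norm_mult norm_power power_mult_distrib)
      have "0 \<le> (cmod (k z - k 0))\<^sup>2" by simp
      also have "\<dots> = (cmod (k z))\<^sup>2 - (Re (2 * cnj (k 0) * k z) - (cmod (k 0))\<^sup>2)"
        unfolding cmod_power2 by (simp add: power2_eq_square algebra_simps)
      finally have "s ^ 4 * (Re (2 * cnj (k 0) * k z) - (cmod (k 0))\<^sup>2) \<le> s ^ 4 * (cmod (k z))\<^sup>2"
        using s by (intro mult_left_mono) auto
      moreover have "Re (G z) = Re (f z $ 3) + s ^ 4 * (Re (2 * cnj (k 0) * k z) - (cmod (k 0))\<^sup>2)"
        unfolding G_def by (simp del: of_real_power)
      ultimately show "Re (G z) \<le> 0" using * by linarith
    qed
    moreover have "2 * cnj (k 0) * k 0 = of_real (2 * (cmod (k 0))\<^sup>2)"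
      using complex_norm_square[of "k 0"] by (simp add: mult_ac)
    then have "G 0 = of_real (- t + s ^ 4 * (cmod (k 0))\<^sup>2)"
      unfolding G_def f0s by (simp add: algebra_simps)
    ultimately show ?thesis
      by (simp add: k0 flip: power_mult)
  qed
  show ?thesis
  \<comment> \<open>Let \<open>s\<close> tend to 1, with \<open>x = s ^ 4\<close>.\<close>
  proof (rule field_le_mult_one_interval)
    fix x :: real assume "0 < x" "x < 1"
    then show "x * (\<bar>r\<bar> * cmod a) ^ 4 \<le> t"
      using bound[of "root 4 x"] by simp
  qed
qed

lemma cusp_disc_exists:
  fixes t r :: real and a b :: complex
  assumes t: "0 < t" and r: "0 < r" and a: "a \<noteq> 0"
    and ra: "(r * cmod a) ^ 4 = t" and le: "r * cmod b ^ 3 \<le> 4 * (cmod a)\<^sup>2"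
  shows "\<exists>f. holomorphic_map_on f (ball 0 1) \<and> f ` ball 0 1 \<subseteq> cusp_domain \<and>
           f 0 = vector [0, 0, - of_real t] \<and> deriv_map f 0 = r *\<^sub>R vector [a, b, 0]"
proof -
  \<comment> \<open>Since \<open>(p z)\<^sup>2 - 1 = 4 * k * z / (1 - k * z)\<^sup>2\<close>,
    comparing coefficients of \<open>z ^ 3\<close> forces
    \<open>R ^ 3 * b ^ 3 = 4 * k * R\<^sup>2 * a\<^sup>2\<close>.\<close>
  define k where "k = of_real r * b ^ 3 / (4 * a\<^sup>2)"
  define R where "R = complex_of_real r"
  define p where "p z = (1 + k * z) / (1 - k * z)" for z
  \<comment> \<open>The branch of the power -2/3 of \<open>1 - k * z\<close> with value 1 at 0. It
    is holomorphic on the disc because \<open>1 - k * z\<close> has positive real part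
    there.\<close>
  define q where "q z = exp (- (2/3) * Ln (1 - k * z))" for z
  define f :: "complex \<Rightarrow> complex ^ 3"
    where "f z = vector [R * a * (z * p z), R * b * (z * q z), - of_real t]" for z
  have k1: "cmod k \<le> 1"
    using a r le by (simp add: k_def norm_mult norm_divide norm_power)
  have Re_pos: "0 < Re (1 - k * z)" if "z \<in> ball 0 1" for z
  proof -
    have "cmod (k * z) \<le> 1 * cmod z"
      unfolding norm_mult using k1 by (intro mult_right_mono) auto
    also have "\<dots> < 1" using that by simp
    finally show ?thesis using complex_Re_le_cmod[of "k * z"] by simp
  qed
  have nz: "1 - k * z \<noteq> 0" if "z \<in> ball 0 1" for z
    using Re_pos[OF that] by force
  have slit: "1 - k * z \<notin> \<real>\<^sub>\<le>\<^sub>0" if "z \<in> ball 0 1" for z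
    using Re_pos[OF that] by (metis complex_nonpos_Reals_iff not_le)
  have p: "p holomorphic_on ball 0 1"
    unfolding p_def by (intro holomorphic_intros nz)
  have q: "q holomorphic_on ball 0 1"
    unfolding q_def by (intro holomorphic_intros slit)
  have q3: "q z ^ 3 = 1 / (1 - k * z)\<^sup>2" if "z \<in> ball 0 1" for z
  proof -
    have "q z ^ 3 = exp (- (2 * Ln (1 - k * z)))"
      unfolding q_def by (simp flip: exp_of_nat_mult)
    also have "\<dots> = inverse (exp (Ln (1 - k * z)) ^ 2)"
      by (simp add: exp_minus flip: exp_of_nat_mult)
    finally show ?thesis using nz[OF that] by (simp add: divide_inverse)
  qed
  have key: "(f z $ 1)\<^sup>2 - f z $ 2 ^ 3 = R\<^sup>2 * a\<^sup>2 * z\<^sup>2" if "z \<in> ball 0 1" for z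
  proof -
    have Rb: "R ^ 3 * b ^ 3 = 4 * k * R\<^sup>2 * a\<^sup>2"
      using a by (simp add: k_def R_def field_simps power2_eq_square power3_eq_cube)
    have "(f z $ 1)\<^sup>2 - f z $ 2 ^ 3 = R\<^sup>2 * a\<^sup>2 * z\<^sup>2 * (p z)\<^sup>2 - R ^ 3 * b ^ 3 * z ^ 3 * q z ^ 3"
      by (simp add: f_def power_mult_distrib)
    also have "\<dots> = R\<^sup>2 * a\<^sup>2 * z\<^sup>2 * ((1 + k * z)\<^sup>2 - 4 * (k * z)) / (1 - k * z)\<^sup>2"
      unfolding Rb q3[OF that] p_def
      by (simp add: power_divide diff_divide_distrib right_diff_distrib)
         (simp add: power2_eq_square power3_eq_cube mult_ac)
    also have "(1 + k * z)\<^sup>2 - 4 * (k * z) = (1 - k * z)\<^sup>2"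
      by (simp add: power2_eq_square algebra_simps)
    finally show ?thesis using nz[OF that] by simp
  qed
  have deriv: "deriv (\<lambda>z. c * (z * g z)) 0 = c * g 0" if "g holomorphic_on ball 0 1" for c g
  proof -
    have "(g has_field_derivative deriv g 0) (at 0)"
      using that by (intro holomorphic_derivI[of _ "ball 0 1"]) auto
    then have "((\<lambda>z. c * (z * g z)) has_field_derivative c * g 0) (at 0)"
      by (auto intro!: derivative_eq_intros)
    then show ?thesis by (rule DERIV_imp_deriv)
  qed
  have "holomorphic_map_on f (ball 0 1)"
    unfolding holomorphic_map_on_def f_def forall_3 vector_3
    by (intro conjI holomorphic_intros p q)
  moreover have "f z \<in> cusp_domain" if z: "z \<in> ball 0 1" for z
  proof -
    have "(cmod ((f z $ 1)\<^sup>2 - f z $ 2 ^ 3))\<^sup>2 = t * cmod z ^ 4"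
      unfolding key[OF z] using r
      by (simp add: R_def norm_mult norm_power power_mult_distrib flip: ra power_mult)
    also have "\<dots> < t * 1"
      using t z by (intro mult_strict_left_mono power_less_one_iff[THEN iffD2]) auto
    finally show ?thesis by (simp add: cusp_domain_def f_def)
  qed
  moreover have "f 0 = vector [0, 0, - of_real t]"
    by (simp add: f_def)
  moreover have "deriv_map f 0 = r *\<^sub>R vector [a, b, 0]"
    unfolding vec_eq_iff forall_3 deriv_map_def f_def
    by (simp add: deriv[OF p] deriv[OF q]) (simp add: p_def q_def R_def scaleR_conv_of_real[of r a] scaleR_conv_of_real[of r b])
  ultimately show ?thesis by blast
qed

theorem proposition2p5:
  fixes t :: real and a b :: complex
  assumes "0 < t" and "t < 1"
    and "a \<noteq> 0"
    and "(cmod a)\<^sup>2 + (cmod b)\<^sup>2 = 1"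
    and "(cmod b) ^ 3 / (cmod a) ^ 3
           \<le> 2 / sqrt t * min (2 * pi) (ln (1 + 2 * t powr (1/4)))"
  shows "kobayashi cusp_domain (vector [0, 0, - of_real t]) (vector [a, b, 0])
           = cmod a * t powr (- 1/4)"
proof -
  define q where "q = t powr (1/4)"
  have q: "0 < q" "q ^ 4 = t" "t powr (- 1/4) = 1 / q"
    using assms(1) by (simp_all add: q_def powr_power powr_minus_divide)
  have "(q\<^sup>2)\<^sup>2 = t"
    using q(2) by (simp flip: power_mult)
  then have sq: "sqrt t = q\<^sup>2"
    by (intro real_sqrt_unique) auto
  \<comment> \<open>Bound the minimum by its logarithm, and \<open>ln (1 + 2 * q)\<close> by
    \<open>2 * q\<close>.\<close>
  have "cmod b ^ 3 / cmod a ^ 3 \<le> 2 / sqrt t * (2 * q)"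
    using assms(1,5) ln_add_one_self_le_self[of "2 * q"] q(1)
    by (elim order_trans) (intro mult_left_mono, auto simp: q_def min_le_iff_disj)
  also have "\<dots> = 4 / q"
    using q(1) by (simp add: sq power2_eq_square)
  \<comment> \<open>This is the condition for the explicit disc with \<open>r = q / cmod a\<close>,
    the value at which the lower bound becomes an equality.\<close>
  finally have le: "q / cmod a * cmod b ^ 3 \<le> 4 * (cmod a)\<^sup>2"
    using q(1) assms(3) by (simp add: field_simps power2_eq_square power3_eq_cube)
  show ?thesis
    unfolding kobayashi_def q(3)
  proof (rule cInf_eq_minimum, goal_cases)
    case 1
    show ?case
      using cusp_disc_exists[of t "q / cmod a" a b] assms(1,3) q le
      by (auto intro!: exI[of _ "q / cmod a"])
  next
    case (2 x)
    then obtain r f where x: "x = 1 / r" and r: "r > 0"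
      and f: "holomorphic_map_on f (ball 0 1)" "f ` ball 0 1 \<subseteq> cusp_domain"
        "f 0 = vector [0, 0, - of_real t]" "deriv_map f 0 = r *\<^sub>R vector [a, b, 0]"
      by auto
    have "(r * cmod a) ^ 4 \<le> q ^ 4"
      using cusp_disc_derivative_bound[OF f] r q(2) by simp
    then have "r * cmod a \<le> q"
      using q(1) by (simp add: power_mono_iff r less_imp_le)
    then show ?case
      using r q(1) by (simp add: x field_simps)
  qed
qed

end
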